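(* Fix a context $q$, a nonempty finite menu $V\subset\mathcal A$, and an action $a_V\in V$. The following statements are equivalent: (1) $\mathcal E_{q,a_V}\succeq_B\mathcal E_{q,a}$ for every $a\in V$; (2) for every $n\ge 1$, the $n$-fold product experiment $\mathcal E_{q,a_V}^{\otimes n}$ Blackwell-dominates the complete $n$-stage action-outcome record generated by every randomized and history-adaptive policy using $V$; (3) for $n=1$, $\mathcal E_{q,a_V}$ Blackwell-dominates the record generated by every deterministic policy using one action in $V$. Consequently, all menu policies using $V$ reduce to repeated use of one action for every decision problem if and only if the one-observation menu $\{\mathcal E_{q,a}:a\in V\}$ has a greatest element in the Blackwell order.
   Context: $\Theta\subseteq\mathbb R$ is a parameter space, $\mathcal Q$ a context space, $\mathcal A$ a space of actions. For each $(q,a)$ one observation is drawn from the experiment $\mathcal E_{q,a}=(\mathcal Y_{q,a},\mathcal F_{q,a},\{P_{\theta,q,a}:\theta\in\Theta\})$. For two experiments $\mathcal E,\mathcal G$ with the same parameter space, $\mathcal E\succeq_B\mathcal G$ ($\mathcal E$ Blackwell-dominates $\mathcal G$) means that $\mathcal G$ is obtained from $\mathcal E$ through a Markov kernel that does not depend on $\theta$. For a fixed nonempty finite menu $V\subset\mathcal A$, labeled observations live in the measurable disjoint union $\mathsf Y_{q,V}=\bigsqcup_{a\in V}(\{a\}\times\mathcal Y_{q,a})$ with $\sigma$-field $\mathsf F_{q,V}=\{\bigsqcup_{a\in V}(\{a\}\times B_a): B_a\in\mathcal F_{q,a}\}$. The complete $n$-stage record $(A_i,Y_i)_{i\le n}$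 is an element of $(\mathsf Y_{q,V}^n,\mathsf F_{q,V}^{\otimes n})$. A (randomized, history-adaptive) policy using $V$ is a sequence of parameter-free Markov kernels, the stage-$i$ one from the preceding record $(A_j,Y_j)_{j<i}$ to the finite set $V$: at stage $i$ it draws $A_i\in V$ from this kernel (possibly depending on the known $q$), and then $Y_i\sim P_{\theta,q,A_i}$ is observed. Action labels are retained in the record. A deterministic one-stage policy selects a fixed $a\in V$. "All menu policies reduce to repeated use of one action for every decision problem" means: there is a single $a\in V$ such that, for every $n$ and every policy using $V$, the record of the policy is obtained from $\mathcal E_{q,a}^{\otimes n}$ by a parameter-free Markov kernel, so that for any decision problem every decision rule based on the record can be simulated from $n$ repetitions of $a$. A greatest element is a member $\mathcal E_{q,a}$, $a\in V$, with $\mathcal E_{q,a}\succeq_B\mathcal E_{q,a'}$ for all $a'\in V$. *)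

theory Defs
  imports "HOL-Probability.Probability"
begin

text \<open>
  The \<^typ>\<open>'x measure\<close> in \<open>obs\<close> only serves as a measurable space: its carrier and its
  \<open>\<sigma>\<close>-field are used, its measure is ignored. Different experiments of the same type may
  have different carriers and \<open>\<sigma>\<close>-fields.
\<close>

record 'x stat_experiment =
  obs :: "'x measure"
  law :: "real \<Rightarrow> 'x measure"

text \<open>
  Non-emptiness of the sample space follows from the second condition as soon as
  \<open>\<Theta> \<noteq> {}\<close>; it is listed so that the degenerate case \<open>\<Theta> = {}\<close> is covered as well.
\<close>

definition is_experiment :: "real set \<Rightarrow> 'x stat_experiment \<Rightarrow> bool" where
  "is_experiment \<Theta> E \<longleftrightarrow>
     space (obs E) \<noteq> {} \<and>
     (\<forall>\<theta>\<in>\<Theta>. prob_space (law E \<theta>) \<and> sets (law E \<theta>) = sets (obs E))"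

text \<open>
  A Markov kernel from \<open>M\<close> to \<open>N\<close> is a measurable map from \<open>M\<close> into
  \<open>prob_algebra N\<close>, the space of probability measures on \<open>N\<close>;
  \<open>\<bind>\<close> integrates a kernel against a measure.
\<close>

definition blackwell_dominates ::
    "real set \<Rightarrow> 'x stat_experiment \<Rightarrow> 'z stat_experiment \<Rightarrow> bool" where
  "blackwell_dominates \<Theta> E G \<longleftrightarrow>
     (\<exists>K \<in> obs E \<rightarrow>\<^sub>M prob_algebra (obs G). \<forall>\<theta>\<in>\<Theta>. law G \<theta> = law E \<theta> \<bind> K)"

definition product_experiment :: "nat \<Rightarrow> 'x stat_experiment \<Rightarrow> (nat \<Rightarrow> 'x) stat_experiment" where
  "product_experiment n E =
     \<lparr>obs = (\<Pi>\<^sub>M i\<in>{..<n}. obs E), law = (\<lambda>\<theta>. \<Pi>\<^sub>M i\<in>{..<n}. law E \<theta>)\<rparr>"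

text \<open>
  From here on \<open>E a\<close> is the experiment run by action \<open>a\<close> in a fixed context.
\<close>

definition labeled_obs :: "('a \<Rightarrow> 'y stat_experiment) \<Rightarrow> 'a set \<Rightarrow> ('a \<times> 'y) measure" where
  "labeled_obs E V =
     sigma (SIGMA a:V. space (obs (E a)))
           {(SIGMA a:V. B a) | B. \<forall>a\<in>V. B a \<in> sets (obs (E a))}"

text \<open>Stages are numbered from \<open>0\<close>, so an \<open>n\<close>-stage record is indexed by \<open>{..<n}\<close>.\<close>

definition record_obs ::
    "('a \<Rightarrow> 'y stat_experiment) \<Rightarrow> 'a set \<Rightarrow> nat \<Rightarrow> (nat \<Rightarrow> 'a \<times> 'y) measure" where
  "record_obs E V n = (\<Pi>\<^sub>M i\<in>{..<n}. labeled_obs E V)"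

type_synonym ('a, 'y) policy = "nat \<Rightarrow> (nat \<Rightarrow> 'a \<times> 'y) \<Rightarrow> 'a measure"

definition is_policy ::
    "('a \<Rightarrow> 'y stat_experiment) \<Rightarrow> 'a set \<Rightarrow> ('a, 'y) policy \<Rightarrow> bool" where
  "is_policy E V \<kappa> \<longleftrightarrow>
     (\<forall>i. \<kappa> i \<in> record_obs E V i \<rightarrow>\<^sub>M prob_algebra (count_space V))"

text \<open>
  Given the record \<open>h\<close> of the first \<open>n\<close> stages, the action \<open>a\<close> is drawn from \<open>\<kappa> n h\<close>, then
  the observation \<open>y\<close> from the law of \<open>E a\<close>, and \<open>(a, y)\<close> is appended to the record.
\<close>

primrec record_law ::
    "('a \<Rightarrow> 'y stat_experiment) \<Rightarrow> 'a set \<Rightarrow> ('a, 'y) policy \<Rightarrow> real \<Rightarrow> nat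
       \<Rightarrow> (nat \<Rightarrow> 'a \<times> 'y) measure" where
  "record_law E V \<kappa> \<theta> 0 = return (record_obs E V 0) (\<lambda>_. undefined)"
| "record_law E V \<kappa> \<theta> (Suc n) =
     record_law E V \<kappa> \<theta> n \<bind> (\<lambda>h.
       \<kappa> n h \<bind> (\<lambda>a.
         distr (law (E a) \<theta>) (record_obs E V (Suc n)) (\<lambda>y. h(n := (a, y)))))"

definition record_experiment ::
    "('a \<Rightarrow> 'y stat_experiment) \<Rightarrow> 'a set \<Rightarrow> ('a, 'y) policy \<Rightarrow> nat
       \<Rightarrow> (nat \<Rightarrow> 'a \<times> 'y) stat_experiment" where
  "record_experiment E V \<kappa> n =
     \<lparr>obs = record_obs E V n, law = (\<lambda>\<theta>. record_law E V \<kappa> \<theta> n)\<rparr>"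

definition deterministic_policy :: "'a set \<Rightarrow> 'a \<Rightarrow> ('a, 'y) policy" where
  "deterministic_policy V a = (\<lambda>i h. return (count_space V) a)"

definition policies_reduce_to_one_action ::
    "real set \<Rightarrow> ('a \<Rightarrow> 'y stat_experiment) \<Rightarrow> 'a set \<Rightarrow> bool" where
  "policies_reduce_to_one_action \<Theta> E V \<longleftrightarrow>
     (\<exists>a\<in>V. \<forall>n\<ge>1. \<forall>\<kappa>. is_policy E V \<kappa> \<longrightarrow>
        blackwell_dominates \<Theta> (product_experiment n (E a)) (record_experiment E V \<kappa> n))"

definition has_greatest_experiment ::
    "real set \<Rightarrow> ('a \<Rightarrow> 'y stat_experiment) \<Rightarrow> 'a set \<Rightarrow> bool" where
  "has_greatest_experiment \<Theta> E V \<longleftrightarrow>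
     (\<exists>a\<in>V. \<forall>a'\<in>V. blackwell_dominates \<Theta> (E a) (E a'))"

end

theory Submission
  imports Defs
begin

text \<open>
  If the action \<open>a\<^sub>V\<close> dominates every action of the menu, keep one kernel \<open>K a\<close> simulating
  \<open>\<E> q a\<close> from \<open>\<E> q a\<^sub>V\<close> for each \<open>a\<close>. The record of a policy is simulated stage by stage:
  draw the action from the policy applied to the record simulated so far, and turn the next
  observation of \<open>a\<^sub>V\<close> into an outcome of that action through its kernel. Since the new
  observation is independent of the simulated record, integrating it out gives back
  the true conditional law of the stage. Conversely, dominating the record of the
  deterministic policy that selects \<open>a\<close> yields domination of \<open>\<E> q a\<close> by forgetting the label.
\<close>

section \<open>Experiments and finite products of probability measures\<close>

lemma is_experimentD:
  assumes "is_experiment \<Theta> G"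
  shows "space (obs G) \<noteq> {}"
    and "\<theta> \<in> \<Theta> \<Longrightarrow> prob_space (law G \<theta>)"
    and "\<theta> \<in> \<Theta> \<Longrightarrow> sets (law G \<theta>) = sets (obs G)"
    and "\<theta> \<in> \<Theta> \<Longrightarrow> law G \<theta> \<in> space (prob_algebra (obs G))"
  using assms by (auto simp: is_experiment_def space_prob_algebra)

text \<open>The product of \<open>Suc n\<close> copies is the image of \<open>P\<close> times the
  product of \<open>n\<close> copies under appending coordinate \<open>n\<close>, and a bind against
  a binary product is an iterated bind. The newest coordinate is placed outermost so that it can be
  held fixed while the earlier ones are integrated.\<close>

lemma bind_PiM_lessThan_Suc:
  assumes P: "prob_space P"
    and F: "F \<in> (\<Pi>\<^sub>M i\<in>{..<Suc n}. P) \<rightarrow>\<^sub>M subprob_algebra N"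
  shows "(\<Pi>\<^sub>M i\<in>{..<Suc n}. P) \<bind> F
           = P \<bind> (\<lambda>y. (\<Pi>\<^sub>M i\<in>{..<n}. P) \<bind> (\<lambda>f. F (f(n := y))))"
proof -
  let ?Pn = "\<Pi>\<^sub>M i\<in>{..<n}. P" and ?PS = "\<Pi>\<^sub>M i\<in>{..<Suc n}. P"
  interpret Y: prob_space P by fact
  interpret Pn: prob_space ?Pn by (intro prob_space_PiM P)
  interpret pair_prob_space P ?Pn ..
  have upd: "(\<lambda>(y, f). f(n := y)) \<in> P \<Otimes>\<^sub>M ?Pn \<rightarrow>\<^sub>M ?PS"
    unfolding split_beta' by (rule measurable_fun_upd[where J = "{..<n}"]) auto
  note F' = measurable_compose[OF upd F]
  have "?PS \<bind> F = distr (P \<Otimes>\<^sub>M ?Pn) ?PS (\<lambda>(y, f). f(n := y)) \<bind> F"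
    using distr_pair_PiM_eq_PiM[of "{..<n}" "\<lambda>_. P" n] P
    by (simp add: lessThan_Suc)
  also have "\<dots> = (P \<Otimes>\<^sub>M ?Pn) \<bind> (\<lambda>z. F (case z of (y, f) \<Rightarrow> f(n := y)))"
    using upd F by (rule bind_distr) (simp add: not_empty)
  also have "\<dots> = P \<bind> (\<lambda>y. ?Pn \<bind> (\<lambda>f. F (f(n := y))))"
  proof -
    \<comment> \<open>\<open>pair_measure_eq_bind\<close> writes the product measure as an iterated
      bind of point masses. After reassociation, \<open>bind_return\<close> absorbs each point mass
      into \<open>F\<close>.\<close>
    have ret: "(\<lambda>(y, f). return (P \<Otimes>\<^sub>M ?Pn) (y, f)) \<in> P \<Otimes>\<^sub>M ?Pn \<rightarrow>\<^sub>M subprob_algebra (P \<Otimes>\<^sub>M ?Pn)"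
      by simp
    have in1: "(\<lambda>y. ?Pn \<bind> (\<lambda>f. return (P \<Otimes>\<^sub>M ?Pn) (y, f)))
        \<in> P \<rightarrow>\<^sub>M subprob_algebra (P \<Otimes>\<^sub>M ?Pn)"
      by (rule measurable_bind'[OF measurable_const ret])
        (simp add: space_subprob_algebra Pn.subprob_space_axioms)
    have "(P \<Otimes>\<^sub>M ?Pn) \<bind> (\<lambda>z. F (case z of (y, f) \<Rightarrow> f(n := y)))
        = P \<bind> (\<lambda>y. (?Pn \<bind> (\<lambda>f. return (P \<Otimes>\<^sub>M ?Pn) (y, f)))
            \<bind> (\<lambda>z. F (case z of (y, f) \<Rightarrow> f(n := y))))"
      by (subst pair_measure_eq_bind) (rule bind_assoc[OF in1 F'])
    also have "\<dots> = P \<bind> (\<lambda>y. ?Pn \<bind> (\<lambda>f. F (f(n := y))))"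
    proof (rule bind_cong[OF refl])
      fix y assume y: "y \<in> space P"
      have "(\<lambda>f. return (P \<Otimes>\<^sub>M ?Pn) (y, f)) \<in> ?Pn \<rightarrow>\<^sub>M subprob_algebra (P \<Otimes>\<^sub>M ?Pn)"
        using y by measurable
      note bind_assoc[OF this F']
      also have "?Pn \<bind> (\<lambda>f. return (P \<Otimes>\<^sub>M ?Pn) (y, f) \<bind> (\<lambda>z. F (case z of (y, f) \<Rightarrow> f(n := y))))
          = ?Pn \<bind> (\<lambda>f. F (f(n := y)))"
        using y by (intro bind_cong[OF refl]) (simp add: bind_return[OF F'] space_pair_measure)
      finally show "(?Pn \<bind> (\<lambda>f. return (P \<Otimes>\<^sub>M ?Pn) (y, f)))
          \<bind> (\<lambda>z. F (case z of (y, f) \<Rightarrow> f(n := y))) = ?Pn \<bind> (\<lambda>f. F (f(n := y)))" .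
    qed
    finally show ?thesis .
  qed
  finally show ?thesis .
qed

section \<open>The measurable disjoint union of labeled observations\<close>

lemma space_labeled_obs: "space (labeled_obs E V) = (SIGMA a:V. space (obs (E a)))"
  unfolding labeled_obs_def
  by (intro space_measure_of) (auto dest!: bspec dest: sets.sets_into_space)

text \<open>Complements and countable unions can be taken fibre by fibre, so the generating family
  is already a sigma-algebra. Measurability questions on the disjoint union thereby reduce to its
  fibres.\<close>

lemma sets_labeled_obs:
  "sets (labeled_obs E V) = {(SIGMA a:V. B a) | B. \<forall>a\<in>V. B a \<in> sets (obs (E a))}"
proof -
  let ?\<Omega> = "SIGMA a:V. space (obs (E a))"
    and ?F = "{(SIGMA a:V. B a) | B. \<forall>a\<in>V. B a \<in> sets (obs (E a))}"
  have sub: "?F \<subseteq> Pow ?\<Omega>"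
    by (auto dest!: bspec dest: sets.sets_into_space)
  have "sigma_algebra ?\<Omega> ?F"
    unfolding sigma_algebra_iff2
  proof (intro conjI ballI allI impI sub)
    show "{} \<in> ?F" by (auto intro!: exI[of _ "\<lambda>_. {}"])
  next
    fix s assume "s \<in> ?F"
    then obtain B where B: "s = (SIGMA a:V. B a)" "\<forall>a\<in>V. B a \<in> sets (obs (E a))" by blast
    have "?\<Omega> - s = (SIGMA a:V. space (obs (E a)) - B a)" using B by auto
    then show "?\<Omega> - s \<in> ?F" using B(2) by blast
  next
    fix A :: "nat \<Rightarrow> _" assume "range A \<subseteq> ?F"
    then have "\<forall>i. \<exists>B. A i = (SIGMA a:V. B a) \<and> (\<forall>a\<in>V. B a \<in> sets (obs (E a)))" by blast
    then obtain B where B: "\<And>i. A i = (SIGMA a:V. B i a)"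
      "\<And>i a. a \<in> V \<Longrightarrow> B i a \<in> sets (obs (E a))" by metis
    have "(\<Union>i. A i) = (SIGMA a:V. \<Union>i. B i a)" using B(1) by auto
    moreover have "\<forall>a\<in>V. (\<Union>i. B i a) \<in> sets (obs (E a))" using B(2) by blast
    ultimately show "(\<Union>i. A i) \<in> ?F" by blast
  qed
  then show ?thesis
    unfolding labeled_obs_def using sub by (simp add: sigma_algebra.sigma_sets_eq)
qed

lemma measurable_label:
  assumes "a \<in> V"
  shows "Pair a \<in> obs (E a) \<rightarrow>\<^sub>M labeled_obs E V"
proof (rule measurableI)
  fix A assume "A \<in> sets (labeled_obs E V)"
  then obtain B where B: "A = (SIGMA a:V. B a)" "\<forall>a\<in>V. B a \<in> sets (obs (E a))"
    unfolding sets_labeled_obs by blast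
  have "Pair a -` A \<inter> space (obs (E a)) = B a"
    using B assms by (auto dest: sets.sets_into_space)
  then show "Pair a -` A \<inter> space (obs (E a)) \<in> sets (obs (E a))"
    using B assms by simp
qed (use assms in \<open>simp add: space_labeled_obs\<close>)

text \<open>This is the universal property of the disjoint union: a preimage is assembled from the
  preimages on the fibres.\<close>

lemma measurable_labeled_obs:
  assumes "\<And>a. a \<in> V \<Longrightarrow> (\<lambda>y. f (a, y)) \<in> obs (E a) \<rightarrow>\<^sub>M N"
  shows "f \<in> labeled_obs E V \<rightarrow>\<^sub>M N"
proof (rule measurableI)
  fix z assume "z \<in> space (labeled_obs E V)"
  then show "f z \<in> space N"
    using assms[THEN measurable_space] by (auto simp: space_labeled_obs)
next
  fix A assume A: "A \<in> sets N"
  have "f -` A \<inter> space (labeled_obs E V) = (SIGMA a:V. (\<lambda>y. f (a, y)) -` A \<inter> space (obs (E a)))"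
    by (auto simp: space_labeled_obs)
  then show "f -` A \<inter> space (labeled_obs E V) \<in> sets (labeled_obs E V)"
    using measurable_sets[OF assms A] unfolding sets_labeled_obs by blast
qed

section \<open>The transition law of one stage\<close>

text \<open>The observation laws \<open>Q\<close> are left free so that one transition serves both
  records: \<open>Q a\<close> is \<open>law (E a) \<theta>\<close> for the true record, and the
  simulating kernel evaluated at an observation for the simulated one.\<close>

definition stage_law ::
    "('a \<Rightarrow> 'y stat_experiment) \<Rightarrow> 'a set \<Rightarrow> ('a, 'y) policy \<Rightarrow> nat
       \<Rightarrow> ('a \<Rightarrow> 'y measure) \<Rightarrow> (nat \<Rightarrow> 'a \<times> 'y) \<Rightarrow> (nat \<Rightarrow> 'a \<times> 'y) measure" where
  "stage_law E V \<kappa> n Q h =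
     \<kappa> n h \<bind> (\<lambda>a. distr (Q a) (record_obs E V (Suc n)) (\<lambda>y. h(n := (a, y))))"

lemma record_law_Suc:
  "record_law E V \<kappa> \<theta> (Suc n)
     = record_law E V \<kappa> \<theta> n \<bind> stage_law E V \<kappa> n (\<lambda>a. law (E a) \<theta>)"
  by (simp add: stage_law_def[abs_def])

lemma measurable_append_record:
  assumes a: "a \<in> V"
  shows "(\<lambda>(h, y). h(n := (a, y))) \<in> record_obs E V n \<Otimes>\<^sub>M obs (E a) \<rightarrow>\<^sub>M record_obs E V (Suc n)"
  unfolding record_obs_def split_beta'
  by (rule measurable_fun_upd[where J = "{..<n}"])
    (auto intro: measurable_compose[OF measurable_snd measurable_label[OF a]])

lemma measurable_append_outcome:
  assumes "a \<in> V" "h \<in> space (record_obs E V n)"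
  shows "(\<lambda>y. h(n := (a, y))) \<in> obs (E a) \<rightarrow>\<^sub>M record_obs E V (Suc n)"
  using measurable_Pair2[OF measurable_append_record[OF assms(1)] assms(2)] by simp

lemma measurable_append_law:
  assumes a: "a \<in> V"
    and Q: "Q \<in> L \<rightarrow>\<^sub>M prob_algebra (obs (E a))"
    and H: "H \<in> L \<rightarrow>\<^sub>M record_obs E V n"
  shows "(\<lambda>x. distr (Q x) (record_obs E V (Suc n)) (\<lambda>y. (H x)(n := (a, y))))
           \<in> L \<rightarrow>\<^sub>M prob_algebra (record_obs E V (Suc n))"
proof (rule measurable_distr_prob_space2[OF Q])
  have "(\<lambda>(x, y). (H x, y)) \<in> L \<Otimes>\<^sub>M obs (E a) \<rightarrow>\<^sub>M record_obs E V n \<Otimes>\<^sub>M obs (E a)"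
    using H by measurable
  from measurable_compose[OF this measurable_append_record[OF a]]
  show "(\<lambda>(x, y). (H x)(n := (a, y))) \<in> L \<Otimes>\<^sub>M obs (E a) \<rightarrow>\<^sub>M record_obs E V (Suc n)"
    by (simp add: split_beta')
qed

text \<open>The action ranges over a countable set with its discrete sigma-field, so the maps for
  fixed actions glue to a jointly measurable one, even though the space on which \<open>Q a\<close>
  lives varies with \<open>a\<close>.\<close>

lemma measurable_append_law_pair:
  assumes V: "countable V"
    and Q: "\<And>a. a \<in> V \<Longrightarrow> Q a \<in> L \<rightarrow>\<^sub>M prob_algebra (obs (E a))"
    and H: "H \<in> L \<rightarrow>\<^sub>M record_obs E V n"
  shows "(\<lambda>(x, a). distr (Q a x) (record_obs E V (Suc n)) (\<lambda>y. (H x)(n := (a, y))))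
           \<in> L \<Otimes>\<^sub>M count_space V \<rightarrow>\<^sub>M prob_algebra (record_obs E V (Suc n))"
  unfolding split_beta'
proof (rule measurable_compose_countable'[OF _ measurable_snd V])
  fix a assume a: "a \<in> V"
  show "(\<lambda>z. distr (Q a (fst z)) (record_obs E V (Suc n)) (\<lambda>y. (H (fst z))(n := (a, y))))
      \<in> L \<Otimes>\<^sub>M count_space V \<rightarrow>\<^sub>M prob_algebra (record_obs E V (Suc n))"
    by (rule measurable_compose[OF measurable_fst measurable_append_law[OF a Q[OF a] H]])
qed

text \<open>The auxiliary space \<open>L\<close> lets the observation laws and the past record vary
  together. In the simulation it is a product of a space of observations with a record
  space.\<close>

lemma measurable_stage_law:
  assumes V: "countable V" and \<kappa>: "is_policy E V \<kappa>"
    and Q: "\<And>a. a \<in> V \<Longrightarrow> Q a \<in> L \<rightarrow>\<^sub>M prob_algebra (obs (E a))"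
    and H: "H \<in> L \<rightarrow>\<^sub>M record_obs E V n"
  shows "(\<lambda>x. stage_law E V \<kappa> n (\<lambda>a. Q a x) (H x)) \<in> L \<rightarrow>\<^sub>M prob_algebra (record_obs E V (Suc n))"
  unfolding stage_law_def
proof (rule measurable_bind_prob_space2)
  show "(\<lambda>x. \<kappa> n (H x)) \<in> L \<rightarrow>\<^sub>M prob_algebra (count_space V)"
    by (rule measurable_compose[OF H]) (use \<kappa> in \<open>simp add: is_policy_def\<close>)
  show "(\<lambda>(x, a). distr (Q a x) (record_obs E V (Suc n)) (\<lambda>y. (H x)(n := (a, y))))
      \<in> L \<Otimes>\<^sub>M count_space V \<rightarrow>\<^sub>M prob_algebra (record_obs E V (Suc n))"
    by (rule measurable_append_law_pair[OF V Q H])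
qed

lemma policy_prob_space:
  assumes "is_policy E V \<kappa>" "h \<in> space (record_obs E V n)"
  shows "prob_space (\<kappa> n h)" "sets (\<kappa> n h) = sets (count_space V)"
  using assms measurable_space[of "\<kappa> n" "record_obs E V n" "prob_algebra (count_space V)" h]
  by (auto simp: is_policy_def space_prob_algebra)

text \<open>Given the past \<open>h\<close>, the action and the fresh observation \<open>x\<close>
  are drawn independently. Push-forward commutes with mixing over \<open>x\<close>
  (\<open>distr_bind\<close>), and the draws of \<open>x\<close> and of the action can be exchanged
  (\<open>bind_rotate\<close>, a form of Fubini).\<close>

lemma stage_law_bind:
  assumes V: "countable V" and \<kappa>: "is_policy E V \<kappa>"
    and P: "prob_space P"
    and K: "\<And>a. a \<in> V \<Longrightarrow> K a \<in> P \<rightarrow>\<^sub>M prob_algebra (obs (E a))"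
    and h: "h \<in> space (record_obs E V n)"
  shows "stage_law E V \<kappa> n (\<lambda>a. P \<bind> K a) h = P \<bind> (\<lambda>x. stage_law E V \<kappa> n (\<lambda>a. K a x) h)"
proof -
  let ?R = "record_obs E V (Suc n)"
  note \<kappa>h = policy_prob_space[OF \<kappa> h]
  interpret Y: prob_space P by fact
  interpret \<kappa>h: prob_space "\<kappa> n h" by (rule \<kappa>h)
  interpret pair_prob_space P "\<kappa> n h" ..
  have sp: "space (\<kappa> n h) = V"
    using sets_eq_imp_space_eq[OF \<kappa>h(2)] by simp
  have C: "(\<lambda>(x, a). distr (K a x) ?R (\<lambda>y. h(n := (a, y)))) \<in> P \<Otimes>\<^sub>M \<kappa> n h \<rightarrow>\<^sub>M subprob_algebra ?R"
    using measurable_prob_algebraD[OF measurable_append_law_pair[OF V K measurable_const[OF h]]]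
    by (simp add: measurable_cong_sets[OF sets_pair_measure_cong[OF refl \<kappa>h(2)] refl])
  have "stage_law E V \<kappa> n (\<lambda>a. P \<bind> K a) h
      = \<kappa> n h \<bind> (\<lambda>a. P \<bind> (\<lambda>x. distr (K a x) ?R (\<lambda>y. h(n := (a, y)))))"
    unfolding stage_law_def
    by (intro bind_cong[OF refl] distr_bind[OF measurable_prob_algebraD[OF K] Y.not_empty]
        measurable_append_outcome h) (auto simp: sp)
  also have "\<dots> = P \<bind> (\<lambda>x. \<kappa> n h \<bind> (\<lambda>a. distr (K a x) ?R (\<lambda>y. h(n := (a, y)))))"
    by (rule bind_rotate[OF C, symmetric])
  finally show ?thesis by (simp add: stage_law_def)
qed

section \<open>Simulating a record from repetitions of one experiment\<close>

text \<open>Stage \<open>n\<close> consumes only the fresh coordinate \<open>x n\<close>. The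
  restriction to \<open>{..<n}\<close> is there because points of the smaller product space must be
  \<open>undefined\<close> outside that index set.\<close>

primrec simulate_record ::
    "('a \<Rightarrow> 'y stat_experiment) \<Rightarrow> 'a set \<Rightarrow> ('a, 'y) policy \<Rightarrow> ('a \<Rightarrow> 'x \<Rightarrow> 'y measure)
       \<Rightarrow> nat \<Rightarrow> (nat \<Rightarrow> 'x) \<Rightarrow> (nat \<Rightarrow> 'a \<times> 'y) measure" where
  "simulate_record E V \<kappa> K 0 x = return (record_obs E V 0) (\<lambda>_. undefined)"
| "simulate_record E V \<kappa> K (Suc n) x =
     simulate_record E V \<kappa> K n (restrict x {..<n}) \<bind> stage_law E V \<kappa> n (\<lambda>a. K a (x n))"

lemma undefined_in_record_obs_0: "(\<lambda>_. undefined) \<in> space (record_obs E V 0)"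
  by (simp add: record_obs_def space_PiM)

lemma measurable_simulate_record:
  assumes V: "countable V" and \<kappa>: "is_policy E V \<kappa>"
    and K: "\<And>a. a \<in> V \<Longrightarrow> K a \<in> M \<rightarrow>\<^sub>M prob_algebra (obs (E a))"
  shows "simulate_record E V \<kappa> K n \<in> (\<Pi>\<^sub>M i\<in>{..<n}. M) \<rightarrow>\<^sub>M prob_algebra (record_obs E V n)"
proof (induction n)
  case 0
  show ?case
    using undefined_in_record_obs_0[of E V]
    by (simp add: space_prob_algebra prob_space_return)
next
  case (Suc n)
  let ?L = "(\<Pi>\<^sub>M i\<in>{..<Suc n}. M) \<Otimes>\<^sub>M record_obs E V n"
  have obs_n: "(\<lambda>z. fst z n) \<in> ?L \<rightarrow>\<^sub>M M"
    by measurable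
  have "(\<lambda>x. simulate_record E V \<kappa> K n (restrict x {..<n}) \<bind> stage_law E V \<kappa> n (\<lambda>a. K a (x n)))
      \<in> (\<Pi>\<^sub>M i\<in>{..<Suc n}. M) \<rightarrow>\<^sub>M prob_algebra (record_obs E V (Suc n))"
  proof (rule measurable_bind_prob_space2)
    show "(\<lambda>x. simulate_record E V \<kappa> K n (restrict x {..<n}))
        \<in> (\<Pi>\<^sub>M i\<in>{..<Suc n}. M) \<rightarrow>\<^sub>M prob_algebra (record_obs E V n)"
      by (rule measurable_compose[OF measurable_restrict_subset Suc.IH]) auto
    show "(\<lambda>(x, h). stage_law E V \<kappa> n (\<lambda>a. K a (x n)) h) \<in> ?L \<rightarrow>\<^sub>M prob_algebra (record_obs E V (Suc n))"
      unfolding split_beta'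
      by (intro measurable_stage_law[OF V \<kappa>] measurable_compose[OF obs_n K] measurable_snd)
  qed
  then show ?case by simp
qed

text \<open>The last observation is independent of the simulated past. With it split off as the
  outermost variable, the first \<open>n\<close> stages keep their simulated law, which is the true
  one by induction. Exchanging the two integrals averages the new stage over that observation, and
  \<open>stage_law_bind\<close> identifies this average as the true stage.\<close>

lemma simulate_record_law:
  assumes V: "countable V" and \<kappa>: "is_policy E V \<kappa>"
    and P: "prob_space P"
    and K: "\<And>a. a \<in> V \<Longrightarrow> K a \<in> P \<rightarrow>\<^sub>M prob_algebra (obs (E a))"
    and law: "\<And>a. a \<in> V \<Longrightarrow> law (E a) \<theta> = P \<bind> K a"
  shows "record_law E V \<kappa> \<theta> n = (\<Pi>\<^sub>M i\<in>{..<n}. P) \<bind> simulate_record E V \<kappa> K n"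
proof (induction n)
  case 0
  show ?case
    using undefined_in_record_obs_0[of E V]
    by (simp add: bind_const' prob_space_PiM P prob_space_return prob_space_imp_subprob_space)
next
  case (Suc n)
  let ?Pn = "\<Pi>\<^sub>M i\<in>{..<n}. P" and ?G = "simulate_record E V \<kappa> K n"
    and ?S = "\<lambda>y. stage_law E V \<kappa> n (\<lambda>a. K a y)"
  interpret Y: prob_space P by fact
  interpret Pn: prob_space ?Pn by (intro prob_space_PiM P)
  have G: "simulate_record E V \<kappa> K m \<in> (\<Pi>\<^sub>M i\<in>{..<m}. P) \<rightarrow>\<^sub>M prob_algebra (record_obs E V m)" for m
    by (rule measurable_simulate_record[OF V \<kappa> K])
  have "?Pn \<bind> ?G \<in> space (prob_algebra (record_obs E V n))"
    by (rule measurable_space[OF measurable_bind_prob_space[OF measurable_const G]])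
      (auto simp: space_prob_algebra Pn.prob_space_axioms)
  then have R: "prob_space (?Pn \<bind> ?G)" "sets (?Pn \<bind> ?G) = sets (record_obs E V n)"
    by (auto simp: space_prob_algebra)
  interpret R: prob_space "?Pn \<bind> ?G" by (rule R)
  interpret pair_prob_space P "?Pn \<bind> ?G" ..
  have S: "(\<lambda>(y, h). ?S y h) \<in> P \<Otimes>\<^sub>M record_obs E V n \<rightarrow>\<^sub>M subprob_algebra (record_obs E V (Suc n))"
    unfolding split_beta'
    by (intro measurable_prob_algebraD measurable_stage_law[OF V \<kappa>]
        measurable_compose[OF measurable_fst K] measurable_snd)
  then have C: "(\<lambda>(y, h). ?S y h)
      \<in> P \<Otimes>\<^sub>M (?Pn \<bind> ?G) \<rightarrow>\<^sub>M subprob_algebra (record_obs E V (Suc n))"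
    by (simp add: measurable_cong_sets[OF sets_pair_measure_cong[OF refl R(2)] refl])
  have "(\<Pi>\<^sub>M i\<in>{..<Suc n}. P) \<bind> simulate_record E V \<kappa> K (Suc n)
      = P \<bind> (\<lambda>y. ?Pn \<bind> (\<lambda>f. simulate_record E V \<kappa> K (Suc n) (f(n := y))))"
    by (rule bind_PiM_lessThan_Suc[OF P measurable_prob_algebraD[OF G]])
  \<comment> \<open>Since \<open>f\<close> is extensional on \<open>{..<n}\<close>, restricting
    \<open>f(n := y)\<close> gives back \<open>f\<close>.\<close>
  also have "\<dots> = P \<bind> (\<lambda>y. ?Pn \<bind> (\<lambda>f. ?G f \<bind> ?S y))"
    by (intro bind_cong refl)
      (auto simp: space_PiM PiE_restrict restrict_fupd)
  also have "\<dots> = P \<bind> (\<lambda>y. (?Pn \<bind> ?G) \<bind> ?S y)"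
  proof (rule bind_cong[OF refl])
    fix y assume "y \<in> space P"
    from measurable_Pair2[OF S this]
    have "?S y \<in> record_obs E V n \<rightarrow>\<^sub>M subprob_algebra (record_obs E V (Suc n))" by simp
    then show "?Pn \<bind> (\<lambda>f. ?G f \<bind> ?S y) = (?Pn \<bind> ?G) \<bind> ?S y"
      by (rule bind_assoc[OF measurable_prob_algebraD[OF G], symmetric])
  qed
  \<comment> \<open>Independence enters here: the law of the simulated past does not involve
    \<open>y\<close>, so \<open>y\<close> may be integrated after \<open>h\<close> is fixed.\<close>
  also have "\<dots> = (?Pn \<bind> ?G) \<bind> (\<lambda>h. P \<bind> (\<lambda>y. ?S y h))"
    by (rule bind_rotate[OF C])
  also have "\<dots> = (?Pn \<bind> ?G) \<bind> stage_law E V \<kappa> n (\<lambda>a. law (E a) \<theta>)"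
  proof (rule bind_cong[OF refl])
    fix h assume "h \<in> space (?Pn \<bind> ?G)"
    then have h: "h \<in> space (record_obs E V n)"
      using sets_eq_imp_space_eq[OF R(2)] by simp
    have "P \<bind> (\<lambda>y. ?S y h) = stage_law E V \<kappa> n (\<lambda>a. P \<bind> K a) h"
      by (rule stage_law_bind[OF V \<kappa> P K h, symmetric])
    \<comment> \<open>The laws are identified only for actions in \<open>V\<close>, which is exactly
      the space of \<open>\<kappa> n h\<close>.\<close>
    also have "\<dots> = stage_law E V \<kappa> n (\<lambda>a. law (E a) \<theta>) h"
      unfolding stage_law_def
      by (rule bind_cong[OF refl])
        (use law sets_eq_imp_space_eq[OF policy_prob_space(2)[OF \<kappa> h]] in simp)
    finally show "P \<bind> (\<lambda>y. ?S y h) = stage_law E V \<kappa> n (\<lambda>a. law (E a) \<theta>) h" .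
  qed
  also have "\<dots> = record_law E V \<kappa> \<theta> (Suc n)"
    unfolding record_law_Suc Suc.IH ..
  finally show ?case ..
qed

lemma blackwell_dominates_record:
  assumes V: "countable V"
    and E\<^sub>0: "is_experiment \<Theta> E\<^sub>0"
    and dom: "\<And>a. a \<in> V \<Longrightarrow> blackwell_dominates \<Theta> E\<^sub>0 (E a)"
    and \<kappa>: "is_policy E V \<kappa>"
  shows "blackwell_dominates \<Theta> (product_experiment n E\<^sub>0) (record_experiment E V \<kappa> n)"
proof -
  have "\<forall>a\<in>V. \<exists>K. K \<in> obs E\<^sub>0 \<rightarrow>\<^sub>M prob_algebra (obs (E a)) \<and> (\<forall>\<theta>\<in>\<Theta>. law (E a) \<theta> = law E\<^sub>0 \<theta> \<bind> K)"
    using dom unfolding blackwell_dominates_def by blast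
  \<comment> \<open>The kernels are chosen before any \<open>\<theta>\<close> is fixed, so the
    simulation built from them is parameter-free.\<close>
  then obtain K where K: "\<And>a. a \<in> V \<Longrightarrow> K a \<in> obs E\<^sub>0 \<rightarrow>\<^sub>M prob_algebra (obs (E a))"
    and law: "\<And>a \<theta>. a \<in> V \<Longrightarrow> \<theta> \<in> \<Theta> \<Longrightarrow> law (E a) \<theta> = law E\<^sub>0 \<theta> \<bind> K a"
    by metis
  have "record_law E V \<kappa> \<theta> n = (\<Pi>\<^sub>M i\<in>{..<n}. law E\<^sub>0 \<theta>) \<bind> simulate_record E V \<kappa> K n"
    if \<theta>: "\<theta> \<in> \<Theta>" for \<theta>
    using K is_experimentD(3)[OF E\<^sub>0 \<theta>]
    by (intro simulate_record_law[OF V \<kappa>] is_experimentD(2)[OF E\<^sub>0 \<theta>] law \<theta>)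
      (simp_all cong: measurable_cong_sets)
  then show ?thesis
    unfolding blackwell_dominates_def product_experiment_def record_experiment_def
    using measurable_simulate_record[OF V \<kappa> K] by auto
qed

section \<open>Recovering an experiment from a one-stage record\<close>

lemma is_policy_deterministic:
  "a \<in> V \<Longrightarrow> is_policy E V (deterministic_policy V a)"
  by (simp add: is_policy_def deterministic_policy_def space_prob_algebra prob_space_return)

text \<open>The empty past and the action are both point masses, so two uses of
  \<open>bind_return\<close> collapse the binds. Each use needs a measurable kernel over the whole
  menu, hence the condition on the laws of all \<open>b\<close> in \<open>V\<close>.\<close>

lemma record_law_deterministic:
  fixes E :: "'a \<Rightarrow> 'y stat_experiment"
  assumes V: "countable V" and a: "a \<in> V"
    and law: "\<And>b. b \<in> V \<Longrightarrow> law (E b) \<theta> \<in> space (prob_algebra (obs (E b)))"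
  shows "record_law E V (deterministic_policy V a) \<theta> 1
    = distr (law (E a) \<theta>) (record_obs E V 1) (\<lambda>y. (\<lambda>_. undefined)(0 := (a, y)))"
proof -
  let ?\<kappa> = "deterministic_policy V a" and ?u = "\<lambda>_::nat. undefined :: 'a \<times> 'y"
  note u = undefined_in_record_obs_0[of E V]
  have "stage_law E V ?\<kappa> 0 (\<lambda>b. law (E b) \<theta>)
      \<in> record_obs E V 0 \<rightarrow>\<^sub>M subprob_algebra (record_obs E V (Suc 0))"
    by (intro measurable_prob_algebraD measurable_stage_law[OF V is_policy_deterministic[OF a]]
        measurable_const law) simp_all
  from bind_return[OF this u]
  have "record_law E V ?\<kappa> \<theta> 1 = stage_law E V ?\<kappa> 0 (\<lambda>b. law (E b) \<theta>) ?u"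
    unfolding One_nat_def record_law_Suc by simp
  also have "\<dots> = distr (law (E a) \<theta>) (record_obs E V (Suc 0)) (\<lambda>y. ?u(0 := (a, y)))"
    unfolding stage_law_def deterministic_policy_def
  proof (rule bind_return)
    show "(\<lambda>b. distr (law (E b) \<theta>) (record_obs E V (Suc 0)) (\<lambda>y. ?u(0 := (b, y))))
        \<in> count_space V \<rightarrow>\<^sub>M subprob_algebra (record_obs E V (Suc 0))"
      unfolding measurable_count_space_eq1
    proof
      fix b assume b: "b \<in> V"
      have "(\<lambda>M. distr M (record_obs E V (Suc 0)) (\<lambda>y. ?u(0 := (b, y))))
          \<in> subprob_algebra (obs (E b)) \<rightarrow>\<^sub>M subprob_algebra (record_obs E V (Suc 0))"
        by (rule measurable_distr[OF measurable_append_outcome[OF b u]])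
      moreover have "law (E b) \<theta> \<in> space (subprob_algebra (obs (E b)))"
        using law[OF b] by (simp add: space_prob_algebra space_subprob_algebra prob_space_imp_subprob_space)
      ultimately show "distr (law (E b) \<theta>) (record_obs E V (Suc 0)) (\<lambda>y. ?u(0 := (b, y)))
          \<in> space (subprob_algebra (record_obs E V (Suc 0)))"
        by (rule measurable_space)
    qed
  qed (simp add: a)
  finally show ?thesis by simp
qed

lemma blackwell_dominates_of_record:
  fixes E :: "'a \<Rightarrow> 'y stat_experiment"
  assumes V: "countable V" and a: "a \<in> V"
    and E: "\<And>b. b \<in> V \<Longrightarrow> is_experiment \<Theta> (E b)"
    and dom: "blackwell_dominates \<Theta> E\<^sub>0 (record_experiment E V (deterministic_policy V a) 1)"
    and E\<^sub>0: "is_experiment \<Theta> E\<^sub>0"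
  shows "blackwell_dominates \<Theta> E\<^sub>0 (E a)"
proof -
  let ?R = "record_obs E V 1" and ?u = "\<lambda>_::nat. undefined :: 'a \<times> 'y"
  obtain K where K: "K \<in> obs E\<^sub>0 \<rightarrow>\<^sub>M prob_algebra ?R"
    and K_law: "\<And>\<theta>. \<theta> \<in> \<Theta> \<Longrightarrow> record_law E V (deterministic_policy V a) \<theta> 1 = law E\<^sub>0 \<theta> \<bind> K"
    using dom unfolding blackwell_dominates_def record_experiment_def stat_experiment.simps by blast
  \<comment> \<open>Outcomes under labels other than \<open>a\<close> need not lie in the sample
    space of \<open>E a\<close>. They are sent to the default \<open>y\<^sub>0\<close>, which makes
    \<open>forget\<close> measurable on every fibre; the record of the policy selecting
    \<open>a\<close> never carries such labels.\<close>
  obtain y\<^sub>0 where y\<^sub>0: "y\<^sub>0 \<in> space (obs (E a))"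
    using is_experimentD(1)[OF E[OF a]] by blast
  define forget where "forget = (\<lambda>(b, y). if b = a then y else y\<^sub>0)"
  have forget: "forget \<in> labeled_obs E V \<rightarrow>\<^sub>M obs (E a)"
  proof (rule measurable_labeled_obs)
    show "(\<lambda>y. forget (b, y)) \<in> obs (E b) \<rightarrow>\<^sub>M obs (E a)" for b
      using y\<^sub>0 by (cases "b = a") (simp_all add: forget_def)
  qed
  have outcome: "(\<lambda>r. forget (r 0)) \<in> ?R \<rightarrow>\<^sub>M obs (E a)"
    unfolding record_obs_def
    by (rule measurable_compose[OF _ forget], rule measurable_component_singleton) simp
  have "law (E a) \<theta> = law E\<^sub>0 \<theta> \<bind> (\<lambda>x. distr (K x) (obs (E a)) (\<lambda>r. forget (r 0)))"
    if \<theta>: "\<theta> \<in> \<Theta>" for \<theta>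
  proof -
    note sets_a = is_experimentD(3)[OF E[OF a] \<theta>]
    have app: "(\<lambda>y. ?u(0 := (a, y))) \<in> law (E a) \<theta> \<rightarrow>\<^sub>M ?R"
      using measurable_append_outcome[OF a undefined_in_record_obs_0] sets_a
      by (simp cong: measurable_cong_sets)
    \<comment> \<open>Attaching the label \<open>a\<close> and then forgetting it is the identity on
      outcomes, so the law of \<open>E a\<close> is an image of the record law. The required kernel
      is therefore \<open>K\<close> followed by this push-forward.\<close>
    have "law (E a) \<theta> = distr (law (E a) \<theta>) (obs (E a)) ((\<lambda>r. forget (r 0)) \<circ> (\<lambda>y. ?u(0 := (a, y))))"
      using sets_a by (simp add: forget_def comp_def distr_id2)
    also have "\<dots> = distr (record_law E V (deterministic_policy V a) \<theta> 1) (obs (E a)) (\<lambda>r. forget (r 0))"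
      by (simp only: record_law_deterministic[OF V a is_experimentD(4)[OF E \<theta>]] distr_distr[OF outcome app])
    also have "\<dots> = law E\<^sub>0 \<theta> \<bind> (\<lambda>x. distr (K x) (obs (E a)) (\<lambda>r. forget (r 0)))"
      unfolding K_law[OF \<theta>]
    proof (rule distr_bind[OF _ _ outcome])
      show "K \<in> law E\<^sub>0 \<theta> \<rightarrow>\<^sub>M subprob_algebra ?R"
        using measurable_prob_algebraD[OF K] is_experimentD(3)[OF E\<^sub>0 \<theta>]
        by (simp cong: measurable_cong_sets)
      show "space (law E\<^sub>0 \<theta>) \<noteq> {}"
        using is_experimentD(2)[OF E\<^sub>0 \<theta>] by (rule prob_space.not_empty)
    qed
    finally show ?thesis .
  qed
  then show ?thesis
    unfolding blackwell_dominates_def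
    using measurable_compose[OF K measurable_distr_prob_space[OF outcome]] by blast
qed

text \<open>The one-fold product lives on functions with index set \<open>{..<1}\<close>, so it is
  not literally \<open>E\<^sub>0\<close>. Coordinate \<open>0\<close> identifies the two, which
  connects the product formulation at \<open>n = 1\<close> with the single-observation one.\<close>

lemma blackwell_dominates_of_product_1:
  assumes E\<^sub>0: "is_experiment \<Theta> E\<^sub>0"
    and dom: "blackwell_dominates \<Theta> (product_experiment 1 E\<^sub>0) G"
  shows "blackwell_dominates \<Theta> E\<^sub>0 G"
proof -
  obtain K where K: "K \<in> (\<Pi>\<^sub>M i\<in>{..<1::nat}. obs E\<^sub>0) \<rightarrow>\<^sub>M prob_algebra (obs G)"
    and K_law: "\<And>\<theta>. \<theta> \<in> \<Theta> \<Longrightarrow> law G \<theta> = (\<Pi>\<^sub>M i\<in>{..<1}. law E\<^sub>0 \<theta>) \<bind> K"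
    using dom unfolding blackwell_dominates_def product_experiment_def stat_experiment.simps by blast
  define K' where "K' = (\<lambda>y. K (\<lambda>i\<in>{..<1}. y))"
  have K': "K' \<in> obs E\<^sub>0 \<rightarrow>\<^sub>M prob_algebra (obs G)"
    unfolding K'_def by (rule measurable_compose[OF measurable_restrict K]) simp
  have "law G \<theta> = law E\<^sub>0 \<theta> \<bind> K'" if \<theta>: "\<theta> \<in> \<Theta>" for \<theta>
  proof -
    let ?P = "law E\<^sub>0 \<theta>"
    let ?P1 = "\<Pi>\<^sub>M i\<in>{..<1::nat}. ?P"
    note P = is_experimentD(2)[OF E\<^sub>0 \<theta>]
    interpret product_prob_space "\<lambda>_::nat. ?P" "{..<1}" by (intro product_prob_spaceI P)
    have "?P \<bind> K' = distr ?P1 ?P (\<lambda>x. x 0) \<bind> K'"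
      using PiM_component[of 0] by simp
    also have "\<dots> = ?P1 \<bind> (\<lambda>x. K' (x 0))"
    proof (rule bind_distr)
      show "K' \<in> ?P \<rightarrow>\<^sub>M subprob_algebra (obs G)"
        using measurable_prob_algebraD[OF K'] is_experimentD(3)[OF E\<^sub>0 \<theta>]
        by (simp cong: measurable_cong_sets)
    qed (simp, rule P.not_empty)
    also have "\<dots> = ?P1 \<bind> K"
    proof (rule bind_cong[OF refl])
      fix x assume "x \<in> space ?P1"
      \<comment> \<open>Points of the product are extensional, so \<open>x\<close> is determined by
        its only coordinate.\<close>
      then have "(\<lambda>i\<in>{..<1}. x 0) = x"
        by (auto simp: space_PiM PiE_iff extensional_def restrict_def)
      then show "K' (x 0) = K x" by (simp only: K'_def)
    qed
    finally show ?thesis using K_law[OF \<theta>] by simp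
  qed
  then show ?thesis
    unfolding blackwell_dominates_def using K' by blast
qed

section \<open>The equivalences\<close>

text \<open>The three properties are proved in a cycle: simulation, then specialization to
  \<open>n = 1\<close> and deterministic policies, then forgetting the label. They are predicates of
  an action \<open>b\<close> so that they apply both to the given action and under the existential
  quantifier of the final claim.\<close>

lemma menu_equivalences:
  assumes V: "countable V" and E: "\<And>a. is_experiment \<Theta> (E a)"
  defines "best \<equiv> \<lambda>b. \<forall>a\<in>V. blackwell_dominates \<Theta> (E b) (E a)"
    and "all_policies \<equiv> \<lambda>b. \<forall>n\<ge>1. \<forall>\<kappa>. is_policy E V \<kappa> \<longrightarrow>
      blackwell_dominates \<Theta> (product_experiment n (E b)) (record_experiment E V \<kappa> n)"
    and "single_stage \<equiv> \<lambda>b. \<forall>a\<in>V. blackwell_dominates \<Theta> (E b)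
      (record_experiment E V (deterministic_policy V a) 1)"
  shows "best b \<longleftrightarrow> all_policies b" "all_policies b \<longleftrightarrow> single_stage b"
proof -
  have "all_policies b" if "best b"
    using that unfolding best_def all_policies_def
    by (intro allI impI blackwell_dominates_record[OF V E]) simp_all
  moreover have "single_stage b" if "all_policies b"
    unfolding single_stage_def
  proof
    fix a assume "a \<in> V"
    then show "blackwell_dominates \<Theta> (E b) (record_experiment E V (deterministic_policy V a) 1)"
      using that unfolding all_policies_def
      by (intro blackwell_dominates_of_product_1[OF E]) (simp add: is_policy_deterministic)
  qed
  moreover have "best b" if "single_stage b"
    unfolding best_def
  proof
    fix a assume a: "a \<in> V"
    then show "blackwell_dominates \<Theta> (E b) (E a)"
      using that unfolding single_stage_def
      by (intro blackwell_dominates_of_record[OF V a E _ E]) simp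
  qed
  ultimately show "best b \<longleftrightarrow> all_policies b" "all_policies b \<longleftrightarrow> single_stage b" by blast+
qed

theorem theorem2p1:
  fixes \<Theta> :: "real set"
    and \<E> :: "'q \<Rightarrow> 'a \<Rightarrow> 'y stat_experiment"
    and q :: 'q and V :: "'a set" and a\<^sub>V :: 'a
  assumes experiments: "\<And>q a. is_experiment \<Theta> (\<E> q a)"
    and menu: "finite V" "V \<noteq> {}"
    and action: "a\<^sub>V \<in> V"
  shows
    "((\<forall>a\<in>V. blackwell_dominates \<Theta> (\<E> q a\<^sub>V) (\<E> q a))
        \<longleftrightarrow>
      (\<forall>n\<ge>1. \<forall>\<kappa>. is_policy (\<E> q) V \<kappa> \<longrightarrow>
         blackwell_dominates \<Theta> (product_experiment n (\<E> q a\<^sub>V))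
           (record_experiment (\<E> q) V \<kappa> n)))
     \<and>
     ((\<forall>n\<ge>1. \<forall>\<kappa>. is_policy (\<E> q) V \<kappa> \<longrightarrow>
         blackwell_dominates \<Theta> (product_experiment n (\<E> q a\<^sub>V))
           (record_experiment (\<E> q) V \<kappa> n))
        \<longleftrightarrow>
      (\<forall>a\<in>V. blackwell_dominates \<Theta> (\<E> q a\<^sub>V)
         (record_experiment (\<E> q) V (deterministic_policy V a) 1)))
     \<and>
     (policies_reduce_to_one_action \<Theta> (\<E> q) V \<longleftrightarrow>
      has_greatest_experiment \<Theta> (\<E> q) V)"
proof -
  note equiv = menu_equivalences[OF countable_finite[OF menu(1)] experiments]
  \<comment> \<open>The last equivalence holds witness by witness: an action to which all policies
    reduce is the same thing as an action whose experiment is greatest.\<close>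
  show ?thesis
    unfolding policies_reduce_to_one_action_def has_greatest_experiment_def
    by (intro conjI equiv bex_cong[OF refl equiv(1)[symmetric]])
qed

end
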